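(* Let $\bar y$ be a first-stage vector and let $$t^\star(\bar y):=\min_{x\ge 0,\ t\ge 0}\{t:\ Bx+t\,\mathbf e\ge d(\bar y)\}.$$ Then there exists $x\ge 0$ with $Bx\ge d(\bar y)$ if and only if $t^\star(\bar y)=0$. Moreover, if $t^\star(\bar y)>0$, then any optimal solution $\lambda^\star$ of $$\max_{\lambda}\{d(\bar y)^\top\lambda:\ B^\top\lambda\le 0,\ \lambda\ge 0,\ \mathbf e^\top\lambda\le 1\}$$ satisfies $\mathbf e^\top\lambda^\star=1$ and yields the valid feasibility cut $(b-Ay)^\top\lambda^\star\le 0$ (i.e. this inequality holds for every $y$ for which there exists $x\ge 0$ with $Bx\ge d(y)$), and this cut separates $\bar y$, i.e. $(b-A\bar y)^\top\lambda^\star>0$.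
   Context: Data: real matrices $A,B$ and a real vector $b$ of compatible dimensions; $d(y):=b-Ay$. $\mathbf e$ is the all-ones vector. $x$ is a continuous real vector, $t$ a real scalar. All vector inequalities are componentwise. *)

theory Defs
  imports "HOL-Analysis.Analysis"
begin

text \<open>
  The order on \<^typ>\<open>real^'m\<close> is the componentwise one, and \<^term>\<open>1 :: real^'m\<close> is the
  all-ones vector.
\<close>

abbreviation ones :: "real^'m" where
  "ones \<equiv> 1"

definition rhs :: "real^'p^'m \<Rightarrow> real^'m \<Rightarrow> real^'p \<Rightarrow> real^'m" where
  "rhs A b y = b - A *v y"

definition recourse_feasible :: "real^'n^'m \<Rightarrow> real^'m \<Rightarrow> bool" where
  "recourse_feasible B d \<longleftrightarrow> (\<exists>x. 0 \<le> x \<and> d \<le> B *v x)"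

definition elastic_feasible :: "real^'n^'m \<Rightarrow> real^'m \<Rightarrow> real^'n \<Rightarrow> real \<Rightarrow> bool" where
  "elastic_feasible B d x t \<longleftrightarrow> 0 \<le> x \<and> 0 \<le> t \<and> d \<le> B *v x + t *\<^sub>R ones"

text \<open>
  \<^const>\<open>Least\<close> denotes a genuine minimum only if one is attained; otherwise its value is
  unspecified.
\<close>

definition t_star :: "real^'n^'m \<Rightarrow> real^'m \<Rightarrow> real" where
  "t_star B d = (LEAST t. \<exists>x. elastic_feasible B d x t)"

definition dual_feasible :: "real^'n^'m \<Rightarrow> real^'m \<Rightarrow> bool" where
  "dual_feasible B l \<longleftrightarrow> transpose B *v l \<le> 0 \<and> 0 \<le> l \<and> ones \<bullet> l \<le> 1"

definition dual_optimal :: "real^'n^'m \<Rightarrow> real^'m \<Rightarrow> real^'m \<Rightarrow> bool" where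
  "dual_optimal B d l \<longleftrightarrow> is_arg_max (\<lambda>l. d \<bullet> l) (dual_feasible B) l"

end

theory Submission
  imports Defs
begin

text \<open>
  Let \<open>K\<close> be the set of right-hand sides \<open>v\<close> for which some \<open>x \<ge> 0\<close> satisfies \<open>B x \<ge> v\<close>. As a
  linear image of a nonnegative orthant, \<open>K\<close> is a finitely generated convex cone, hence polyhedral
  and closed; everything except the validity of the cut rests on this closedness.

  It makes the infimum \<open>t\<^sup>\<star>\<close> of the values \<open>t \<ge> 0\<close> with \<open>d - t \<^bold>e \<in> K\<close> a minimum, so that
  \<open>t\<^sup>\<star> = 0\<close> says exactly \<open>d \<in> K\<close> (\<open>t_star_is_minimum\<close>). It also yields the Farkas alternative
  (\<open>farkas_certificate\<close>): a point \<open>d \<notin> K\<close> is strictly separated from \<open>K\<close> by a vector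
  \<open>\<lambda> \<ge> 0\<close> with \<open>B\<^sup>T \<lambda> \<le> 0\<close> and \<open>d \<bullet> \<lambda> > 0\<close>.

  If \<open>t\<^sup>\<star> > 0\<close>, such a \<open>\<lambda>\<close> can be scaled into the dual feasible region, so every dual optimum
  \<open>\<lambda>\<^sup>\<star>\<close> has positive value, which is the separation of the current point. The dual constraints other
  than \<open>\<^bold>e \<bullet> \<lambda> \<le> 1\<close> are homogeneous; were this one slack at \<open>\<lambda>\<^sup>\<star>\<close>, scaling \<open>\<lambda>\<^sup>\<star>\<close> up would
  improve the positive objective. Validity of the cut is weak duality:
  \<open>v \<bullet> \<lambda> \<le> B x \<bullet> \<lambda> = x \<bullet> B\<^sup>T \<lambda> \<le> 0\<close> for \<open>v \<in> K\<close>.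
\<close>

section \<open>Componentwise order and inner product\<close>

lemma inner_mono_cart:
  fixes u v l :: "real^'m"
  assumes "u \<le> v" "0 \<le> l"
  shows "u \<bullet> l \<le> v \<bullet> l"
  using assms by (auto simp: inner_vec_def less_eq_vec_def intro!: sum_mono mult_right_mono)

lemma le_norm_scaleR_one:
  fixes d :: "real^'m"
  shows "d \<le> norm d *\<^sub>R 1"
proof -
  have "d $ i \<le> norm d" for i
    using component_le_norm_cart[of d i] by linarith
  then show ?thesis
    by (simp add: less_eq_vec_def)
qed

lemma one_inner_pos:
  fixes l :: "real^'m"
  assumes "0 \<le> l" "l \<noteq> 0"
  shows "1 \<bullet> l > 0"
proof -
  obtain i where i: "l $ i \<noteq> 0"
    using assms(2) by (auto simp: vec_eq_iff)
  have nn: "\<forall>j. 0 \<le> l $ j"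
    using assms(1) by (simp add: less_eq_vec_def)
  have "0 < (\<Sum>j\<in>UNIV. l $ j)"
    using i nn by (intro sum_pos2[of _ i]) (auto simp: less_le)
  then show ?thesis
    by (simp add: inner_vec_def)
qed

section \<open>The cone of feasible right-hand sides\<close>

lemma nonneg_orthant_eq_convex_cone_hull:
  "{z::'a::euclidean_space. \<forall>i\<in>Basis. 0 \<le> z \<bullet> i} = convex_cone hull Basis"
proof
  show "convex_cone hull Basis \<subseteq> {z::'a. \<forall>i\<in>Basis. 0 \<le> z \<bullet> i}"
  proof (rule hull_minimal)
    show "Basis \<subseteq> {z::'a. \<forall>i\<in>Basis. 0 \<le> z \<bullet> i}"
      by (auto simp: inner_Basis)
    show "convex_cone {z::'a. \<forall>i\<in>Basis. 0 \<le> z \<bullet> i}"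
      by (auto simp: convex_cone_iff inner_add_left intro!: exI[of _ 0])
  qed
next
  show "{z::'a. \<forall>i\<in>Basis. 0 \<le> z \<bullet> i} \<subseteq> convex_cone hull Basis"
  proof
    fix z :: 'a
    assume z: "z \<in> {z. \<forall>i\<in>Basis. 0 \<le> z \<bullet> i}"
    have "(\<Sum>i\<in>F. (z \<bullet> i) *\<^sub>R i) \<in> convex_cone hull Basis" if "finite F" "F \<subseteq> Basis" for F
      using that
    proof (induction F rule: finite_induct)
      case empty
      then show ?case
        by (simp add: convex_cone_hull_contains_0)
    next
      case (insert i F)
      then show ?case
        using z by (simp add: convex_cone_hull_add convex_cone_hull_mul hull_inc)
    qed
    from this[of Basis] show "z \<in> convex_cone hull Basis"
      by (simp add: euclidean_representation)
  qed
qed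

text \<open>
  The finite generation obtained here is what makes the cone of feasible right-hand sides closed;
  a linear image of a closed cone need not be closed in general.
\<close>

lemma recourse_cone_finitely_generated:
  fixes B :: "real^'n^'m"
  obtains S where "finite S" "{d. recourse_feasible B d} = convex_cone hull S"
proof -
  let ?f = "\<lambda>(x, s). B *v x - s"
  let ?O = "{z::(real^'n) \<times> (real^'m). \<forall>i\<in>Basis. 0 \<le> z \<bullet> i}"
  have O: "?O = {z. 0 \<le> z}"
    by (subst eucl_le) simp
  have lin: "linear ?f"
    by (rule linearI) (auto simp: algebra_simps matrix_vector_mult_scaleR)
  have "?f ` ?O = {d. recourse_feasible B d}"
  proof (intro set_eqI iffI)
    fix d
    assume "d \<in> ?f ` ?O"
    then show "d \<in> {d. recourse_feasible B d}"
      unfolding O recourse_feasible_def by (auto simp: less_eq_prod_def)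
  next
    fix d
    assume "d \<in> {d. recourse_feasible B d}"
    then obtain x where x: "0 \<le> x" "d \<le> B *v x"
      by (auto simp: recourse_feasible_def)
    then show "d \<in> ?f ` ?O"
      unfolding O by (intro image_eqI[of _ _ "(x, B *v x - d)"]) (auto simp: less_eq_prod_def)
  qed
  then have "{d. recourse_feasible B d} = convex_cone hull (?f ` Basis)"
    using convex_cone_hull_linear_image[OF lin, of Basis]
    by (simp add: nonneg_orthant_eq_convex_cone_hull)
  then show thesis
    by (rule that[rotated]) simp
qed

lemma closed_recourse_cone:
  fixes B :: "real^'n^'m"
  shows "closed {d. recourse_feasible B d}"
  by (metis recourse_cone_finitely_generated polyhedron_convex_cone_hull polyhedron_imp_closed)

lemma convex_cone_recourse_cone:
  fixes B :: "real^'n^'m"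
  shows "convex_cone {d. recourse_feasible B d}"
  by (metis recourse_cone_finitely_generated convex_cone_convex_cone_hull)

section \<open>The minimal slack\<close>

lemma elastic_feasible_iff_recourse:
  "(\<exists>x. elastic_feasible B d x t) \<longleftrightarrow> 0 \<le> t \<and> recourse_feasible B (d - t *\<^sub>R 1)"
  by (auto simp: elastic_feasible_def recourse_feasible_def diff_le_eq)

lemma t_star_is_minimum:
  fixes B :: "real^'n^'m"
  shows "\<exists>x. elastic_feasible B d x (t_star B d)"
    and "elastic_feasible B d x t \<Longrightarrow> t_star B d \<le> t"
proof -
  let ?T = "{t. \<exists>x. elastic_feasible B d x t}"
  have "?T = {0..} \<inter> (\<lambda>t. d - t *\<^sub>R 1) -` {v. recourse_feasible B v}"
    by (auto simp: elastic_feasible_iff_recourse)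
  moreover have "closed ({0..} \<inter> (\<lambda>t. d - t *\<^sub>R 1) -` {v. recourse_feasible B v})"
    by (intro closed_Int closed_vimage closed_recourse_cone continuous_intros closed_atLeast)
  ultimately have closed: "closed ?T"
    by simp
  have bdd: "bdd_below ?T"
    by (rule bdd_belowI[of _ 0]) (auto simp: elastic_feasible_def)
  \<comment> \<open>The slack \<open>t = norm d\<close> alone already covers \<open>d\<close>.\<close>
  have "elastic_feasible B d 0 (norm d)"
    by (simp add: elastic_feasible_def le_norm_scaleR_one)
  then have "?T \<noteq> {}"
    by blast
  then have "Inf ?T \<in> ?T"
    using closed bdd by (intro closed_contains_Inf)
  then have least: "t_star B d = Inf ?T"
    unfolding t_star_def by (intro Least_equality) (auto intro: cInf_lower[OF _ bdd])
  show "\<exists>x. elastic_feasible B d x (t_star B d)"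
    using \<open>Inf ?T \<in> ?T\<close> least by simp
  show "elastic_feasible B d x t \<Longrightarrow> t_star B d \<le> t"
    unfolding least by (rule cInf_lower[OF _ bdd]) blast
qed

lemma recourse_feasible_iff_t_star:
  fixes B :: "real^'n^'m"
  shows "recourse_feasible B d \<longleftrightarrow> t_star B d = 0"
proof
  assume "recourse_feasible B d"
  then have "\<exists>x. elastic_feasible B d x 0"
    by (simp add: elastic_feasible_iff_recourse)
  then have "t_star B d \<le> 0"
    using t_star_is_minimum(2) by blast
  moreover have "0 \<le> t_star B d"
    using t_star_is_minimum(1)[of B d] by (simp add: elastic_feasible_iff_recourse)
  ultimately show "t_star B d = 0"
    by simp
next
  assume "t_star B d = 0"
  then show "recourse_feasible B d"
    using t_star_is_minimum(1)[of B d] by (simp add: elastic_feasible_iff_recourse)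
qed

section \<open>Weak duality and the Farkas alternative\<close>

lemma weak_duality:
  fixes B :: "real^'n^'m"
  assumes "recourse_feasible B d" "transpose B *v l \<le> 0" "0 \<le> l"
  shows "d \<bullet> l \<le> 0"
proof -
  obtain x where x: "0 \<le> x" "d \<le> B *v x"
    using assms(1) by (auto simp: recourse_feasible_def)
  have "d \<bullet> l \<le> (B *v x) \<bullet> l"
    using x(2) assms(3) by (rule inner_mono_cart)
  also have "\<dots> = (transpose B *v l) \<bullet> x"
    by (metis dot_lmul_matrix inner_commute transpose_matrix_vector)
  also have "\<dots> \<le> 0 \<bullet> x"
    using assms(2) x(1) by (rule inner_mono_cart)
  finally show ?thesis
    by simp
qed

text \<open>
  A hyperplane strictly separating \<open>d\<close> from a cone can be moved to pass through the origin: a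
  linear functional that is bounded below on a cone is nonnegative there. Membership of the
  points \<open>- e\<^sub>i\<close> and \<open>B e\<^sub>j\<close> in the cone then gives the sign conditions on its (negated) normal.
\<close>

lemma farkas_certificate:
  fixes B :: "real^'n^'m"
  assumes "\<not> recourse_feasible B d"
  obtains l where "transpose B *v l \<le> 0" "0 \<le> l" "d \<bullet> l > 0"
proof -
  let ?K = "{v. recourse_feasible B v}"
  have cone: "convex_cone ?K"
    by (rule convex_cone_recourse_cone)
  then have "convex ?K"
    by (simp add: convex_cone_def)
  then obtain a \<beta> where d: "a \<bullet> d < \<beta>" and K: "\<And>v. recourse_feasible B v \<Longrightarrow> \<beta> < a \<bullet> v"
    using separating_hyperplane_closed_point[OF _ closed_recourse_cone, of B d] assms by auto
  have "recourse_feasible B 0"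
    using convex_cone_contains_0[OF cone] by simp
  then have \<beta>: "\<beta> < 0"
    using K by fastforce
  have nonneg: "0 \<le> a \<bullet> v" if v: "recourse_feasible B v" for v
  proof (rule ccontr)
    assume neg: "\<not> 0 \<le> a \<bullet> v"
    \<comment> \<open>The multiple of \<open>v\<close> lying on the separating hyperplane would still belong to the cone.\<close>
    have "recourse_feasible B ((\<beta> / (a \<bullet> v)) *\<^sub>R v)"
      using convex_cone_scaleR[OF cone, of "\<beta> / (a \<bullet> v)" v] v \<beta> neg
      by (simp add: divide_nonpos_neg)
    from K[OF this] show False
      using neg by simp
  qed
  show thesis
  proof (rule that[of "- a"])
    have "recourse_feasible B (- axis i 1)" for i
      unfolding recourse_feasible_def
      by (intro exI[of _ 0]) (simp add: less_eq_vec_def axis_def)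
    from nonneg[OF this] show "0 \<le> - a"
      by (simp add: less_eq_vec_def inner_axis)
    have "recourse_feasible B (B *v axis j 1)" for j
      unfolding recourse_feasible_def
      by (intro exI[of _ "axis j 1"]) (simp add: less_eq_vec_def axis_def)
    then have "0 \<le> (transpose B *v a) \<bullet> axis j 1" for j
      using nonneg by (metis dot_lmul_matrix transpose_matrix_vector)
    moreover have "transpose B *v (- a) = - (transpose B *v a)"
      using matrix_vector_mult_scaleR[of "transpose B" "- 1" a] by simp
    ultimately show "transpose B *v (- a) \<le> 0"
      by (simp add: less_eq_vec_def inner_axis)
    show "d \<bullet> (- a) > 0"
      using d \<beta> by (simp add: inner_commute)
  qed
qed

section \<open>Dual optima and feasibility cuts\<close>

text \<open>
  This rescaling serves two purposes: it brings a Farkas certificate into the dual feasible region,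
  and it supplies the better competitor to a dual optimum with \<open>\<^bold>e \<bullet> \<lambda> < 1\<close>.
\<close>

lemma dual_feasible_normalized:
  fixes B :: "real^'n^'m"
  assumes "transpose B *v l \<le> 0" "0 \<le> l" "l \<noteq> 0"
  shows "dual_feasible B ((1 / (1 \<bullet> l)) *\<^sub>R l)"
proof -
  have pos: "1 \<bullet> l > 0"
    using assms(2,3) by (rule one_inner_pos)
  moreover have "(1 / (1 \<bullet> l)) *\<^sub>R (transpose B *v l) \<le> 0"
    using pos assms(1) by (intro scaleR_nonneg_nonpos) auto
  moreover have "0 \<le> (1 / (1 \<bullet> l)) *\<^sub>R l"
    using pos assms(2) by (intro scaleR_nonneg_nonneg) auto
  ultimately show ?thesis
    unfolding dual_feasible_def by (simp add: matrix_vector_mult_scaleR)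
qed

lemma dual_optimal_pos:
  fixes B :: "real^'n^'m"
  assumes "\<not> recourse_feasible B d" "dual_optimal B d l"
  shows "d \<bullet> l > 0"
proof -
  obtain m where m: "transpose B *v m \<le> 0" "0 \<le> m" "d \<bullet> m > 0"
    using farkas_certificate[OF assms(1)] .
  then have "m \<noteq> 0"
    by auto
  then have "dual_feasible B ((1 / (1 \<bullet> m)) *\<^sub>R m)" "1 \<bullet> m > 0"
    using m dual_feasible_normalized one_inner_pos by blast+
  then have "d \<bullet> ((1 / (1 \<bullet> m)) *\<^sub>R m) \<le> d \<bullet> l"
    using assms(2) by (auto simp: dual_optimal_def is_arg_max_linorder)
  moreover have "d \<bullet> ((1 / (1 \<bullet> m)) *\<^sub>R m) > 0"
    using m(3) \<open>1 \<bullet> m > 0\<close> by simp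
  ultimately show ?thesis
    by linarith
qed

lemma dual_optimal_normalized:
  fixes B :: "real^'n^'m"
  assumes "dual_optimal B d l" "d \<bullet> l > 0"
  shows "1 \<bullet> l = 1"
proof -
  have feas: "transpose B *v l \<le> 0" "0 \<le> l" "1 \<bullet> l \<le> 1" and "l \<noteq> 0"
    using assms by (auto simp: dual_optimal_def is_arg_max_def dual_feasible_def)
  then have "d \<bullet> ((1 / (1 \<bullet> l)) *\<^sub>R l) \<le> d \<bullet> l"
    using assms(1) dual_feasible_normalized[of B l]
    by (auto simp: dual_optimal_def is_arg_max_linorder)
  moreover have "1 \<bullet> l > 0"
    using feas(2) \<open>l \<noteq> 0\<close> by (rule one_inner_pos)
  ultimately have "1 \<le> 1 \<bullet> l"
    using assms(2) by (simp add: field_simps)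
  then show ?thesis
    using feas(3) by simp
qed

theorem theorem3:
  fixes A :: "real^'p^'m" and B :: "real^'n^'m" and b :: "real^'m" and ybar :: "real^'p"
  shows "(\<exists>x. elastic_feasible B (rhs A b ybar) x (t_star B (rhs A b ybar)))
    \<and> (\<forall>x t. elastic_feasible B (rhs A b ybar) x t \<longrightarrow> t_star B (rhs A b ybar) \<le> t)
    \<and> (recourse_feasible B (rhs A b ybar) \<longleftrightarrow> t_star B (rhs A b ybar) = 0)
    \<and> (t_star B (rhs A b ybar) > 0 \<longrightarrow>
        (\<forall>l. dual_optimal B (rhs A b ybar) l \<longrightarrow>
          ones \<bullet> l = 1
          \<and> (\<forall>y. recourse_feasible B (rhs A b y) \<longrightarrow> (b - A *v y) \<bullet> l \<le> 0)
          \<and> (b - A *v ybar) \<bullet> l > 0))"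
proof (intro conjI impI allI)
  show "\<exists>x. elastic_feasible B (rhs A b ybar) x (t_star B (rhs A b ybar))"
    by (rule t_star_is_minimum)
  show "t_star B (rhs A b ybar) \<le> t" if "elastic_feasible B (rhs A b ybar) x t" for x t
    using that by (rule t_star_is_minimum)
  show "recourse_feasible B (rhs A b ybar) \<longleftrightarrow> t_star B (rhs A b ybar) = 0"
    by (rule recourse_feasible_iff_t_star)
next
  fix l
  assume "t_star B (rhs A b ybar) > 0" and opt: "dual_optimal B (rhs A b ybar) l"
  then have "\<not> recourse_feasible B (rhs A b ybar)"
    by (simp add: recourse_feasible_iff_t_star)
  then have pos: "rhs A b ybar \<bullet> l > 0"
    using opt by (rule dual_optimal_pos)
  then show "(b - A *v ybar) \<bullet> l > 0"
    by (simp add: rhs_def)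
  show "ones \<bullet> l = 1"
    using opt pos by (rule dual_optimal_normalized)
  show "(b - A *v y) \<bullet> l \<le> 0" if "recourse_feasible B (rhs A b y)" for y
    using weak_duality[OF that] opt
    by (simp add: dual_optimal_def is_arg_max_def dual_feasible_def rhs_def)
qed

end
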